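(* Let $M$ be an Orlicz function such that $M\in C^2([0,\infty))$ and $M'(0)=M''(0)=0$. Then, for every $0<p\le2$, the three-dimensional Orlicz space $\ell_M^3$ does not embed isometrically in $L_p$.
   Context: All spaces are over the real numbers. An Orlicz function $M$ is a non-decreasing convex function on $[0,\infty)$ such that $M(0)=0$ and $M(t)>0$ for every $t>0$. For an Orlicz function $M$, the $n$-dimensional Orlicz space $\ell_M^n$ is $\mathbb{R}^n$ with the norm defined, for $x\in\mathbb{R}^n\setminus\{0\}$, by the equality $\sum_{k=1}^nM(|x_k|/\|x\|)=1$ (and $\|0\|=0$). $M\in C^2([0,\infty))$ means twice continuously differentiable on $[0,\infty)$, with one-sided derivatives at $0$. $L_p=L_p([0,1])$ (Lebesgue measure), for $p>0$, with $\|f\|_p=(\int_0^1|f|^p)^{1/p}$ (a quasi-norm when $0<p<1$). A normed space $X$ embeds isometrically in $L_p$ if there is a linear map $T:X\to L_p$ with $\|Tx\|_p=\|x\|$ for all $x\in X$. *)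

theory Defs
  imports "HOL-Analysis.Analysis"
begin

definition orlicz_function :: "(real \<Rightarrow> real) \<Rightarrow> bool" where
  "orlicz_function M \<longleftrightarrow>
     mono_on {0..} M \<and> convex_on {0..} M \<and> M 0 = 0 \<and> (\<forall>t>0. M t > 0)"

definition orlicz_norm :: "(real \<Rightarrow> real) \<Rightarrow> real ^ 'n::finite \<Rightarrow> real" where
  "orlicz_norm M x =
     (if x = 0 then 0 else (THE r. 0 < r \<and> (\<Sum>k\<in>UNIV. M (\<bar>x $ k\<bar> / r)) = 1))"

lemma orlicz_function_strict_mono:
  assumes "orlicz_function M" "0 \<le> s" "s < t"
  shows "M s < M t"
proof -
  have c: "convex_on {0..} M" and z: "M 0 = 0" and p: "M t > 0"
    using assms by (auto simp: orlicz_function_def)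
  have "M ((1 - s / t) *\<^sub>R 0 + (s / t) *\<^sub>R t) \<le> (1 - s / t) * M 0 + (s / t) * M t"
    by (rule convex_onD[OF c]) (use assms in auto)
  then have "M s \<le> (s / t) * M t" using z assms by simp
  also have "\<dots> < 1 * M t"
    using p assms by (intro mult_strict_right_mono) auto
  finally show ?thesis by simp
qed

lemma orlicz_function_continuous_on:
  assumes "orlicz_function M"
  shows "continuous_on {0..} M"
proof -
  have c: "convex_on {0..} M" and z: "M 0 = 0" and m: "mono_on {0..} M"
    using assms by (auto simp: orlicz_function_def)
  have nonneg: "0 \<le> M t" if "0 \<le> t" for t
    using mono_onD[OF m, of 0 t] that z by auto
  have le: "M t \<le> t * M 1" if "0 \<le> t" "t \<le> 1" for t
  proof -
    have "M ((1 - t) *\<^sub>R 0 + t *\<^sub>R 1) \<le> (1 - t) * M 0 + t * M 1"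
      by (rule convex_onD[OF c]) (use that in auto)
    then show ?thesis using z by simp
  qed
  have "continuous_on {0<..} M"
    by (rule convex_on_continuous[OF open_greaterThan convex_on_subset[OF c]]) auto
  then have int: "isCont M t" if "0 < t" for t
    using that continuous_on_eq_continuous_at[of "{0<..}" M] by auto
  have "(M \<longlongrightarrow> 0) (at 0 within {0..})"
  proof (rule tendsto_sandwich[of "\<lambda>_. 0" M _ "\<lambda>t. t * M 1"])
    show "\<forall>\<^sub>F t in at 0 within {0..}. 0 \<le> M t"
      by (auto simp: eventually_at_filter nonneg)
    have "\<forall>\<^sub>F t in at 0 within {0..}. (t::real) < 1"
      by (intro order_tendstoD[of "\<lambda>t. t"] tendsto_eq_intros) auto
    moreover have "\<forall>\<^sub>F t in at 0 within {0..}. (t::real) \<ge> 0"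
      by (auto simp: eventually_at_filter)
    ultimately show "\<forall>\<^sub>F t in at 0 within {0..}. M t \<le> t * M 1"
      by eventually_elim (use le in auto)
    show "((\<lambda>t. t * M 1) \<longlongrightarrow> 0) (at 0 within {0..})"
      by (auto intro!: tendsto_eq_intros)
  qed auto
  then have "continuous (at 0 within {0..}) M"
    using z by (simp add: continuous_within)
  then show ?thesis
    unfolding continuous_on_eq_continuous_within
    using int by (metis atLeast_iff continuous_at_imp_continuous_at_within order_le_less)
qed

lemma orlicz_norm_ex1:
  fixes x :: "real ^ 'n::finite"
  assumes M: "orlicz_function M" and x: "x \<noteq> 0"
  shows "\<exists>!r. 0 < r \<and> (\<Sum>k\<in>UNIV. M (\<bar>x $ k\<bar> / r)) = 1"
proof -
  have c: "convex_on {0..} M" and z: "M 0 = 0" and m: "mono_on {0..} M"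
    and pos: "M 1 > 0"
    using M by (auto simp: orlicz_function_def)
  have nonneg: "0 \<le> M t" if "0 \<le> t" for t
    using mono_onD[OF m, of 0 t] that z by auto
  define F where "F = (\<lambda>s. \<Sum>k\<in>UNIV. M (\<bar>x $ k\<bar> * s))"
  obtain j where j: "x $ j \<noteq> 0" using x by (metis vec_eq_iff zero_index)
  have F_mono: "F s < F t" if "0 \<le> s" "s < t" for s t
    unfolding F_def
  proof (rule sum_strict_mono_ex1)
    show "\<forall>k\<in>UNIV. M (\<bar>x $ k\<bar> * s) \<le> M (\<bar>x $ k\<bar> * t)"
      using that by (auto intro!: mono_onD[OF m] mult_left_mono)
    show "\<exists>k\<in>UNIV. M (\<bar>x $ k\<bar> * s) < M (\<bar>x $ k\<bar> * t)"
      using that j by (intro bexI[of _ j] orlicz_function_strict_mono[OF M]) auto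
  qed auto
  have cont: "continuous_on {0..} F"
    unfolding F_def
    by (intro continuous_on_sum continuous_on_compose2[OF orlicz_function_continuous_on[OF M]]
        continuous_intros) auto
  define b where "b = max 1 (1 / M 1)"
  have b: "b \<ge> 1" "b * M 1 \<ge> 1"
    using pos by (auto simp: b_def max_def field_simps)
  have "M ((1 - 1/b) *\<^sub>R 0 + (1/b) *\<^sub>R b) \<le> (1 - 1/b) * M 0 + (1/b) * M b"
    by (rule convex_onD[OF c]) (use b in auto)
  then have "M 1 \<le> M b / b" using b z by simp
  then have "1 \<le> M b" using b by (simp add: field_simps)
  also have "M b = M (\<bar>x $ j\<bar> * (b / \<bar>x $ j\<bar>))" using j by simp
  also have "\<dots> \<le> F (b / \<bar>x $ j\<bar>)"
    unfolding F_def using b by (intro member_le_sum nonneg) auto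
  finally have ub: "1 \<le> F (b / \<bar>x $ j\<bar>)" .
  have F0: "F 0 = 0" by (simp add: F_def z)
  have "\<exists>s. 0 \<le> s \<and> s \<le> b / \<bar>x $ j\<bar> \<and> F s = 1"
    by (rule IVT') (use F0 ub b in \<open>auto intro: continuous_on_subset[OF cont]\<close>)
  then obtain s where s: "0 \<le> s" "F s = 1" by blast
  then have s0: "s > 0" using F0 by (cases "s = 0") auto
  have uniq: "t = s" if "0 < t" "F t = 1" for t
    using F_mono[of s t] F_mono[of t s] that s s0 by (cases t s rule: linorder_cases) auto
  have Fr: "(\<Sum>k\<in>UNIV. M (\<bar>x $ k\<bar> / r)) = F (1 / r)" for r
    by (simp add: F_def)
  show ?thesis
    unfolding Fr
  proof (rule ex1I[of _ "1 / s"])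
    show "0 < 1 / s \<and> F (1 / (1 / s)) = 1" using s s0 by simp
    show "r = 1 / s" if "0 < r \<and> F (1 / r) = 1" for r
      using uniq[of "1 / r"] that by auto
  qed
qed

lemma orlicz_norm_characterization:
  fixes x :: "real ^ 'n::finite"
  assumes "orlicz_function M" "x \<noteq> 0"
  shows "0 < orlicz_norm M x" "(\<Sum>k\<in>UNIV. M (\<bar>x $ k\<bar> / orlicz_norm M x)) = 1"
  using theI'[OF orlicz_norm_ex1[OF assms]] assms(2) by (auto simp: orlicz_norm_def)

text \<open>
  Derivative relative to the half-line \<open>[0, \<infinity>)\<close>: two-sided at positive points and
  one-sided at 0. Only the values on \<open>[0, \<infinity>)\<close> are meaningful.
\<close>

definition deriv_half :: "(real \<Rightarrow> real) \<Rightarrow> real \<Rightarrow> real" where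
  "deriv_half f t = vector_derivative f (at t within {0..})"

definition C2_half :: "(real \<Rightarrow> real) \<Rightarrow> bool" where
  "C2_half f \<longleftrightarrow>
     f differentiable_on {0..} \<and> deriv_half f differentiable_on {0..} \<and>
     continuous_on {0..} (deriv_half (deriv_half f))"

lemma deriv_half_eqI:
  assumes "(f has_real_derivative d) (at t within {0..})" "0 \<le> t"
  shows "deriv_half f t = d"
proof -
  have "at t within {0..} \<noteq> bot"
    unfolding trivial_limit_within not_not
    by (rule islimpt_subset[OF islimpt_greaterThanLessThan1[of t "t + 1"]]) (use assms(2) in auto)
  then show ?thesis
    unfolding deriv_half_def
    by (rule vector_derivative_within)
      (use assms(1) in \<open>simp add: has_real_derivative_iff_has_vector_derivative\<close>)
qed

lemma deriv_half_works:
  assumes "f differentiable_on {0..}" "0 \<le> t"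
  shows "(f has_real_derivative deriv_half f t) (at t within {0..})"
proof -
  obtain d where "(f has_real_derivative d) (at t within {0..})"
    using assms real_differentiable_def unfolding differentiable_on_def by (metis atLeast_iff)
  then show ?thesis using deriv_half_eqI assms(2) by blast
qed

abbreviation unit_interval :: "real measure" where
  "unit_interval \<equiv> lebesgue_on {0..1}"

text \<open>
  Measurable real functions on \<open>[0, 1]\<close> modulo equality almost everywhere; the spaces
  \<open>L\<^sub>p\<close> for all \<open>p > 0\<close> are subsets of this vector space.
\<close>

quotient_type L0 = "real \<Rightarrow> real" / partial:
  "\<lambda>f g. f \<in> borel_measurable unit_interval \<and> g \<in> borel_measurable unit_interval \<and>
         (AE t in unit_interval. f t = g t)"
proof (rule part_equivpI)
  show "\<exists>f::real \<Rightarrow> real. f \<in> borel_measurable unit_interval \<and>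
      f \<in> borel_measurable unit_interval \<and> (AE t in unit_interval. f t = f t)"
    by (rule exI[of _ "\<lambda>_. 0"]) auto
qed (auto simp: symp_def transp_def)

instantiation L0 :: real_vector
begin

lift_definition zero_L0 :: L0 is "\<lambda>_. 0" by auto

lift_definition plus_L0 :: "L0 \<Rightarrow> L0 \<Rightarrow> L0" is "\<lambda>f g t. f t + g t" by auto

lift_definition minus_L0 :: "L0 \<Rightarrow> L0 \<Rightarrow> L0" is "\<lambda>f g t. f t - g t" by auto

lift_definition uminus_L0 :: "L0 \<Rightarrow> L0" is "\<lambda>f t. - f t" by auto

lift_definition scaleR_L0 :: "real \<Rightarrow> L0 \<Rightarrow> L0" is "\<lambda>c f t. c * f t" by auto

instance
  by standard (transfer; auto simp: algebra_simps)+

end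

lift_definition Lp_integrable :: "real \<Rightarrow> L0 \<Rightarrow> bool"
  is "\<lambda>p f. integrable unit_interval (\<lambda>t. \<bar>f t\<bar> powr p)"
  by (intro integrable_cong_AE) auto

lift_definition Lp_norm :: "real \<Rightarrow> L0 \<Rightarrow> real"
  is "\<lambda>p f. (LINT t|unit_interval. \<bar>f t\<bar> powr p) powr (1 / p)"
  by (intro arg_cong2[where f = "(powr)"] integral_cong_AE refl) auto

definition Lp_space :: "real \<Rightarrow> L0 set" where
  "Lp_space p = {f. Lp_integrable p f}"

definition embeds_isometrically_Lp :: "('a::real_vector \<Rightarrow> real) \<Rightarrow> real \<Rightarrow> bool" where
  "embeds_isometrically_Lp N p \<longleftrightarrow>
     (\<exists>T::'a \<Rightarrow> L0. linear T \<and> (\<forall>x. T x \<in> Lp_space p \<and> Lp_norm p (T x) = N x))"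

end

theory Submission
  imports Defs
begin

text \<open>
  Write an isometric embedding into \<open>L\<^sub>p\<close> as \<open>\<parallel>(a, u, v)\<parallel>\<^sup>p = \<integral>\<bar>a f + u g + v h\<bar>\<^sup>p\<close> and average the
  increment \<open>\<parallel>(a, u, v)\<parallel>\<^sup>p - \<parallel>(0, u, v)\<parallel>\<^sup>p\<close> over \<open>(u, v)\<close> in the square \<open>[-1, 1]\<^sup>2\<close>.

  Since \<open>M(t) = o(t\<^sup>2)\<close>, the increment is \<open>o(a\<^sup>2)\<close> for each \<open>(u, v) \<noteq> 0\<close> and at most a constant
  times \<open>a\<^sup>2 \<parallel>(0, u, v)\<parallel>\<^bsup>p-2\<^esup>\<close>. In dimension two this bound is integrable because \<open>p > 0\<close>, so the
  average is \<open>o(a\<^sup>2)\<close> by dominated convergence.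

  On the other hand, on \<open>[-R, R]\<close> the function \<open>\<bar>x\<bar>\<^sup>p\<close> exceeds \<open>(p/2) R\<^bsup>p-2\<^esup> x\<^sup>2\<close> by an even function
  that increases with \<open>\<bar>x\<bar>\<close>, and averaging over symmetric intervals preserves this monotonicity.
  Hence the average of \<open>\<bar>a f + u g + v h\<bar>\<^sup>p - \<bar>u g + v h\<bar>\<^sup>p\<close> is at least that of the quadratic part, which
  is a multiple of \<open>a\<^sup>2 f\<^sup>2\<close>. Therefore \<open>f = 0\<close> almost everywhere, contradicting \<open>\<parallel>(1, 0, 0)\<parallel> > 0\<close>.
\<close>

section \<open>Averages over symmetric windows\<close>

text \<open>The window is parametrised by \<open>u\<close> in [-1, 1], without dividing by its
  width, so that \<open>A\<close> can be any real number: later the widths are values of functions,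
  which may be negative or 0.\<close>

definition interval_sum :: "real \<Rightarrow> (real \<Rightarrow> real) \<Rightarrow> real \<Rightarrow> real" where
  "interval_sum A g x = integral {-1..1} (\<lambda>u. g (x + u * A))"

lemma interval_sum_square: "interval_sum A (\<lambda>x. x\<^sup>2) x = 2 * x\<^sup>2 + 2 / 3 * A\<^sup>2"
proof -
  have "((\<lambda>u. (x + u * A)\<^sup>2) has_integral
      (\<lambda>u. x\<^sup>2 * u + x * A * u\<^sup>2 + A\<^sup>2 * u ^ 3 / 3) 1 - (\<lambda>u. x\<^sup>2 * u + x * A * u\<^sup>2 + A\<^sup>2 * u ^ 3 / 3) (-1))
      {-1..1}"
    by (rule fundamental_theorem_of_calculus)
      (auto intro!: derivative_eq_intros
        simp: has_real_derivative_iff_has_vector_derivative[symmetric] power2_eq_square algebra_simps)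
  then show ?thesis
    unfolding interval_sum_def by (auto dest!: integral_unique)
qed

lemma continuous_on_interval_sum:
  assumes "continuous_on UNIV g"
  shows "continuous_on UNIV (interval_sum A g)"
proof -
  have "continuous_on UNIV (\<lambda>x. integral (cbox (-1) 1) (\<lambda>u. g (x + u * A)))"
    by (rule integral_continuous_on_param)
      (auto simp: split_def intro!: continuous_on_compose2[OF assms] continuous_intros)
  then show ?thesis by (simp add: interval_sum_def[abs_def])
qed

lemma interval_sum_linear:
  assumes "continuous_on UNIV g" "continuous_on UNIV h"
  shows "interval_sum A (\<lambda>x. g x - c * h x) x = interval_sum A g x - c * interval_sum A h x"
proof -
  have 1: "(\<lambda>u. g (x + u * A)) integrable_on {-1..1}" "(\<lambda>u. h (x + u * A)) integrable_on {-1..1}"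
    by (auto intro!: integrable_continuous_real continuous_on_compose2[OF assms(1)]
        continuous_on_compose2[OF assms(2)] continuous_intros)
  show ?thesis
    unfolding interval_sum_def using 1
    by (subst integral_diff) (auto intro: integrable_on_mult_right)
qed

lemma interval_sum_uminus_width: "interval_sum (- A) g x = interval_sum A g x"
  using Henstock_Kurzweil_Integration.integral_reflect_real[of 1 "-1" "\<lambda>u. g (x + u * A)"]
  by (simp add: interval_sum_def)

lemma interval_sum_even:
  assumes "\<And>x. g (- x) = g x"
  shows "interval_sum A g (- x) = interval_sum A g x"
proof -
  have "interval_sum A g (- x) = interval_sum (- A) g x"
    unfolding interval_sum_def
  proof (rule integral_cong)
    fix u :: real
    show "g (- x + u * A) = g (x + u * - A)"
      using assms[of "x + u * - A"] by (simp add: algebra_simps)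
  qed
  then show ?thesis by (simp add: interval_sum_uminus_width)
qed

text \<open>
  The derivative of the sum over a window is proportional to the difference of the values at
  its two ends, and the right end is farther from \<open>0\<close> when the centre is nonnegative.
\<close>

lemma interval_sum_mono_pos:
  assumes g: "continuous_on UNIV g"
    and mono: "\<And>x y. \<bar>x\<bar> \<le> \<bar>y\<bar> \<Longrightarrow> \<bar>y\<bar> \<le> R \<Longrightarrow> g x \<le> g y"
    and "0 \<le> x" "x \<le> y" "y + A \<le> R" "0 < A"
  shows "interval_sum A g x \<le> interval_sum A g y"
proof -
  \<comment> \<open>The base point \<open>-R-1\<close> lies beyond [-R, R], so that \<open>P\<close>
    has a two-sided derivative at the endpoints too.\<close>
  define P where "P = (\<lambda>x. integral {-R-1..x} g)"
  have P: "(P has_real_derivative g z) (at z)" if "\<bar>z\<bar> \<le> R" for z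
  proof -
    have "(P has_real_derivative g z) (at z within {-R-1..R+1})"
      unfolding P_def using that
      by (intro integral_has_real_derivative continuous_on_subset[OF g]) auto
    then show ?thesis
      using that by (subst (asm) at_within_interior) auto
  qed
  have eq: "interval_sum A g z = (P (z + A) - P (z - A)) / A" if z: "0 \<le> z" "z \<le> y" for z
  proof -
    have "((\<lambda>u. g (z + u * A)) has_integral
        (\<lambda>u. P (z + u * A) / A) 1 - (\<lambda>u. P (z + u * A) / A) (-1)) {-1..1}"
    proof (rule fundamental_theorem_of_calculus)
      fix u :: real assume u: "u \<in> {-1..1}"
      then have "\<bar>u * A\<bar> \<le> 1 * A"
        unfolding abs_mult using assms by (intro mult_mono) auto
      then have "\<bar>z + u * A\<bar> \<le> R" using z assms by linarith
      from P[OF this] have "((\<lambda>u. P (z + u * A) / A) has_real_derivative g (z + u * A)) (at u)"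
        using \<open>0 < A\<close> by (auto intro!: derivative_eq_intros DERIV_chain2[of P])
      then show "((\<lambda>u. P (z + u * A) / A) has_vector_derivative g (z + u * A)) (at u within {-1..1})"
        by (simp add: has_real_derivative_iff_has_vector_derivative has_vector_derivative_at_within)
    qed simp
    then show ?thesis
      unfolding interval_sum_def by (auto dest!: integral_unique simp: diff_divide_distrib)
  qed
  have "(\<lambda>z. (P (z + A) - P (z - A)) / A) x \<le> (\<lambda>z. (P (z + A) - P (z - A)) / A) y"
  proof (rule DERIV_nonneg_imp_nondecreasing[OF \<open>x \<le> y\<close>])
    fix z assume z: "x \<le> z" "z \<le> y"
    have "((\<lambda>z. (P (z + A) - P (z - A)) / A) has_real_derivative (g (z + A) - g (z - A)) / A) (at z)"
    proof -
      have "((\<lambda>z. P (z + A)) has_real_derivative g (z + A) * 1) (at z)"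
        "((\<lambda>z. P (z - A)) has_real_derivative g (z - A) * 1) (at z)"
        using z assms by (intro DERIV_chain2[of P] P; auto intro!: derivative_eq_intros)+
      then show ?thesis
        using \<open>0 < A\<close> by (auto intro!: derivative_eq_intros)
    qed
    moreover have "(g (z + A) - g (z - A)) / A \<ge> 0"
      using z assms by (auto intro!: mono divide_nonneg_nonneg)
    ultimately show "\<exists>d. ((\<lambda>z. (P (z + A) - P (z - A)) / A) has_real_derivative d) (at z) \<and> 0 \<le> d"
      by blast
  qed
  then show ?thesis using eq assms by auto
qed

text \<open>Evenness of \<open>g\<close> and reflection of the window replace \<open>A\<close>,
  \<open>x\<close> and \<open>y\<close> by their absolute values. Width 0 is separate because the
  positive case divides by \<open>A\<close>.\<close>

lemma interval_sum_mono:
  assumes g: "continuous_on UNIV g"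
    and mono: "\<And>x y. \<bar>x\<bar> \<le> \<bar>y\<bar> \<Longrightarrow> \<bar>y\<bar> \<le> R \<Longrightarrow> g x \<le> g y"
    and even: "\<And>x. g (- x) = g x"
    and xy: "\<bar>x\<bar> \<le> \<bar>y\<bar>" "\<bar>y\<bar> + \<bar>A\<bar> \<le> R"
  shows "interval_sum A g x \<le> interval_sum A g y"
proof (cases "A = 0")
  case True
  then show ?thesis using mono[OF xy(1)] xy(2) by (simp add: interval_sum_def)
next
  case False
  have a: "interval_sum A g z = interval_sum \<bar>A\<bar> g \<bar>z\<bar>" for z
    using interval_sum_even[of g A z, OF even]
    by (auto simp: abs_if interval_sum_uminus_width)
  show ?thesis unfolding a
    by (rule interval_sum_mono_pos[OF g mono]) (use xy False in auto)
qed

text \<open>The derivative is p z (z^(p-2) - R^(p-2)), nonnegative for 0 < z < R because p - 2 \<le>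
  0; the coefficient p/2 R^(p-2) makes it vanish at R. Only the open interval is differentiated,
  since the power may have no derivative at 0.\<close>

lemma abs_powr_minus_square_mono:
  fixes p :: real
  assumes p: "0 < p" "p \<le> 2" and "0 \<le> x" "x \<le> y" "y \<le> R"
  shows "x powr p - p / 2 * R powr (p - 2) * x\<^sup>2 \<le> y powr p - p / 2 * R powr (p - 2) * y\<^sup>2"
proof (rule DERIV_nonneg_imp_increasing_open[where f = "\<lambda>x. x powr p - p / 2 * R powr (p - 2) * x\<^sup>2"])
  show "x \<le> y" by fact
  show "continuous_on {x..y} (\<lambda>x. x powr p - p / 2 * R powr (p - 2) * x\<^sup>2)"
    using assms by (intro continuous_intros continuous_on_powr') auto
  fix z assume z: "x < z" "z < y"
  then have "0 < z" "z < R" using assms by auto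
  have "((\<lambda>x. x powr p - p / 2 * R powr (p - 2) * x\<^sup>2) has_real_derivative
      p * z powr (p - 1) - p * R powr (p - 2) * z) (at z)"
    using \<open>0 < z\<close> by (auto intro!: derivative_eq_intros)
  moreover have "z powr (p - 1) = z powr (p - 2) * z"
    using \<open>0 < z\<close> powr_add[of z "p - 2" 1] by simp
  moreover have "R powr (p - 2) \<le> z powr (p - 2)"
    using \<open>0 < z\<close> \<open>z < R\<close> p by (intro powr_mono2') auto
  ultimately show "\<exists>d. ((\<lambda>x. x powr p - p / 2 * R powr (p - 2) * x\<^sup>2) has_real_derivative d) (at z) \<and> 0 \<le> d"
    using p \<open>0 < z\<close> by (intro exI conjI) (auto simp: algebra_simps)
qed

text \<open>Subtracting \<alpha> x^2 leaves a function \<open>h\<close> increasing in |x| on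
  [-R, R], where \<open>R\<close> bounds every point the two windows reach. So the double average of
  \<open>h\<close> is at least as large at \<open>c\<close> as at 0. The increment for |x|^p thus
  dominates \<alpha> times that for x^2, which is 4 c^2, and 4 \<alpha> = 2 p R^(p-2).\<close>

lemma interval_sum_abs_powr_increment:
  fixes p :: real
  assumes p: "0 < p" "p \<le> 2"
  defines "g \<equiv> \<lambda>x::real. \<bar>x\<bar> powr p"
  shows "2 * p * (\<bar>c\<bar> + \<bar>A\<bar> + \<bar>B\<bar>) powr (p - 2) * c\<^sup>2
    \<le> interval_sum A (interval_sum B g) c - interval_sum A (interval_sum B g) 0"
proof -
  define R where "R = \<bar>c\<bar> + \<bar>A\<bar> + \<bar>B\<bar>"
  define \<alpha> where "\<alpha> = p / 2 * R powr (p - 2)"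
  define q where "q = (\<lambda>x::real. x\<^sup>2)"
  define h where "h = (\<lambda>x. g x - \<alpha> * q x)"
  have cg: "continuous_on UNIV g" and cq: "continuous_on UNIV q"
    unfolding g_def q_def using p by (auto intro!: continuous_intros continuous_on_powr')
  then have ch: "continuous_on UNIV h"
    unfolding h_def by (intro continuous_intros)
  have mono: "h x \<le> h y" if "\<bar>x\<bar> \<le> \<bar>y\<bar>" "\<bar>y\<bar> \<le> R" for x y
    using abs_powr_minus_square_mono[OF p, of "\<bar>x\<bar>" "\<bar>y\<bar>" R] that
    by (simp add: h_def g_def q_def \<alpha>_def)
  have even: "h (- x) = h x" for x by (simp add: h_def g_def q_def)
  \<comment> \<open>Each averaging shortens the range of monotonicity by its width: from R to |c| +
    |A| for the inner one, then to |c|.\<close>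
  have "interval_sum A (interval_sum B h) 0 \<le> interval_sum A (interval_sum B h) c"
  proof (rule interval_sum_mono[where R = "\<bar>c\<bar> + \<bar>A\<bar>"])
    show "interval_sum B h x \<le> interval_sum B h y" if "\<bar>x\<bar> \<le> \<bar>y\<bar>" "\<bar>y\<bar> \<le> \<bar>c\<bar> + \<bar>A\<bar>" for x y
      by (rule interval_sum_mono[OF ch mono even]) (use that R_def in auto)
  qed (auto intro: continuous_on_interval_sum ch interval_sum_even even)
  moreover have "interval_sum B h = (\<lambda>x. interval_sum B g x - \<alpha> * interval_sum B q x)"
    unfolding h_def using interval_sum_linear[OF cg cq] by blast
  then have "interval_sum A (interval_sum B h) x =
      interval_sum A (interval_sum B g) x - \<alpha> * interval_sum A (interval_sum B q) x" for x
    by (simp add: interval_sum_linear continuous_on_interval_sum cg cq)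
  moreover have "interval_sum A (interval_sum B q) c = 4 * c\<^sup>2 + interval_sum A (interval_sum B q) 0"
  proof -
    \<comment> \<open>The form of a constant minus (-2) times the square matches
      \<open>interval_sum_linear\<close>.\<close>
    have "interval_sum B q = (\<lambda>x. 2 / 3 * B\<^sup>2 - (-2) * x\<^sup>2)"
      unfolding q_def by (auto simp: interval_sum_square)
    then show ?thesis
      by (simp only: interval_sum_linear[OF continuous_on_const cq[unfolded q_def]] interval_sum_square)
        (simp add: interval_sum_def)
  qed
  ultimately show ?thesis
    by (simp add: \<alpha>_def R_def field_simps)
qed

section \<open>Integration over the square\<close>

text \<open>The mass stays 4 instead of 1, so that integrals agree with iterated
  \<open>interval_sum\<close> without extra constants.\<close>

definition square_measure :: "(real \<times> real) measure" where
  "square_measure = restrict_space lborel (cbox (-1, -1) (1, 1))"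

interpretation square_measure: finite_measure square_measure
  unfolding square_measure_def
  by (rule finite_measureI) (simp add: emeasure_restrict_space emeasure_lborel_cbox_eq)

lemma borel_measurable_square_measure:
  "f \<in> borel_measurable borel \<Longrightarrow> f \<in> borel_measurable square_measure"
  unfolding square_measure_def by (rule measurable_restrict_space1) simp

lemma integral_square_measure:
  fixes g :: "real \<Rightarrow> real"
  assumes g: "continuous_on UNIV g"
  shows "integral\<^sup>L square_measure (\<lambda>y. g (c + fst y * A + snd y * B))
    = interval_sum A (interval_sum B g) c"
proof -
  let ?f = "\<lambda>y::real \<times> real. g (c + fst y * A + snd y * B)"
  have cont: "continuous_on X ?f" for X
    by (intro continuous_on_compose2[OF g] continuous_intros) auto
  have "set_integrable lborel (cbox (-1, -1) (1, 1)) ?f"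
    unfolding set_integrable_def by (intro borel_integrable_compact compact_cbox cont)
  from set_borel_integral_eq_integral(2)[OF this]
  have "integral\<^sup>L square_measure ?f = integral (cbox (-1, -1) (1, 1)) ?f"
    unfolding square_measure_def set_lebesgue_integral_def
    by (subst integral_restrict_space) auto
  also have "\<dots> = integral (cbox (-1) 1) (\<lambda>u. integral (cbox (-1) 1) (\<lambda>v. ?f (u, v)))"
    by (rule integral_prod_continuous[OF cont])
  finally show ?thesis by (simp add: interval_sum_def)
qed

lemma integrable_abs_powr:
  fixes q :: real
  assumes "-1 < q"
  shows "integrable lborel (\<lambda>u. indicator {-1..1} u * \<bar>u\<bar> powr q)"
proof -
  have *: "(\<lambda>u::real. \<bar>u\<bar> powr q) integrable_on {0..1}"
    using integrable_on_powr_from_0[OF assms, of 1]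
    by (rule integrable_eq) auto
  then have "(\<lambda>u::real. \<bar>- u\<bar> powr q) integrable_on {-1..-0}"
    by (subst Henstock_Kurzweil_Integration.integrable_reflect_real) simp
  then have "(\<lambda>u::real. \<bar>u\<bar> powr q) integrable_on {-1..1}"
    using * Henstock_Kurzweil_Integration.integrable_combine[of "-1" 0 1 "\<lambda>u. \<bar>u\<bar> powr q"] by simp
  then have "set_integrable lebesgue {-1..1} (\<lambda>u::real. \<bar>u\<bar> powr q)"
    by (intro nonnegative_absolutely_integrable_1) auto
  then show ?thesis
    unfolding set_integrable_def by (subst (asm) integrable_completion) auto
qed

text \<open>A product of one-variable powers avoids polar coordinates. With q = (p-2)/2, which
  exceeds -1 because p > 0, a multiple of it will majorise the difference quotients of the
  norm.\<close>

lemma integrable_square_measure_abs_powr: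
  fixes q :: real
  assumes "-1 < q"
  shows "integrable square_measure (\<lambda>y. \<bar>fst y * snd y\<bar> powr q)"
proof -
  define h :: "real \<Rightarrow> real" where "h = (\<lambda>u. indicator {-1..1} u * \<bar>u\<bar> powr q)"
  have [measurable]: "h \<in> borel_measurable borel" unfolding h_def by measurable
  have h: "integrable lborel h" unfolding h_def by (rule integrable_abs_powr[OF assms])
  have "integrable (lborel \<Otimes>\<^sub>M lborel) (\<lambda>y. h (fst y) * h (snd y))"
    by (rule lborel_pair.Fubini_integrable) (use h in \<open>auto simp: abs_mult\<close>)
  then have "integrable lborel (\<lambda>y. h (fst y) * h (snd y))"
    by (simp add: lborel_prod)
  also have "(\<lambda>y. h (fst y) * h (snd y)) =
      (\<lambda>y. indicator (cbox (-1, -1) (1, 1)) y *\<^sub>R \<bar>fst y * snd y\<bar> powr q)"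
    by (auto simp: h_def indicator_def abs_mult powr_mult fun_eq_iff)
  finally show ?thesis
    unfolding square_measure_def by (subst integrable_restrict_space) auto
qed

lemma AE_square_measure_off_axes: "AE y in square_measure. fst y \<noteq> 0 \<and> snd y \<noteq> 0"
proof -
  have "AE y in lborel \<Otimes>\<^sub>M lborel. fst y \<noteq> (0::real) \<and> snd y \<noteq> (0::real)"
  proof (rule lborel_pair.AE_pair_measure)
    show "AE x in lborel. AE y in lborel. fst (x, y) \<noteq> (0::real) \<and> snd (x, y) \<noteq> (0::real)"
      using AE_lborel_singleton[of "0::real"] by (auto elim!: eventually_mono)
    show "{y \<in> space (lborel \<Otimes>\<^sub>M lborel). fst y \<noteq> (0::real) \<and> snd y \<noteq> (0::real)}
        \<in> sets (lborel \<Otimes>\<^sub>M lborel)"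
      by measurable
  qed
  then have "AE y in lborel. fst y \<noteq> (0::real) \<and> snd y \<noteq> (0::real)"
    by (simp only: lborel_prod)
  then show ?thesis
    unfolding square_measure_def by (subst AE_restrict_space_iff) (auto elim: eventually_mono)
qed

section \<open>Averaged increments of integrals of p-th powers\<close>

text \<open>Comparison with three times the maximum treats p < 1 and p \<ge> 1 alike; the constant
  serves only for integrability.\<close>

lemma add3_powr_le:
  fixes a b c p :: real
  assumes "0 < p" "0 \<le> a" "0 \<le> b" "0 \<le> c"
  shows "(a + b + c) powr p \<le> 3 powr p * (a powr p + b powr p + c powr p)"
proof -
  define m where "m = max a (max b c)"
  have "(a + b + c) powr p \<le> (3 * m) powr p"
    using assms by (intro powr_mono2) (auto simp: m_def)
  also have "\<dots> = 3 powr p * m powr p"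
    using assms by (simp add: powr_mult m_def)
  also have "m powr p \<le> a powr p + b powr p + c powr p"
    using assms by (auto simp: m_def max_def)
  finally show ?thesis by simp
qed

text \<open>Fubini turns the average of the integrals into an integral over \<open>t\<close> of
  double windows with centre \<open>a * f t\<close> and widths \<open>g t\<close> and
  \<open>h t\<close>, to which \<open>interval_sum_abs_powr_increment\<close> applies pointwise. The
  weight \<open>\<kappa>\<close> does not involve \<open>a\<close>, so the lower bound is a constant
  times a^2.\<close>

lemma Lp_square_average_increment:
  fixes f g h :: "'a \<Rightarrow> real" and a p :: real
  assumes "sigma_finite_measure \<mu>"
    and p: "0 < p" "p \<le> 2"
    and meas: "f \<in> borel_measurable \<mu>" "g \<in> borel_measurable \<mu>" "h \<in> borel_measurable \<mu>"
    and int: "integrable \<mu> (\<lambda>t. \<bar>f t\<bar> powr p)" "integrable \<mu> (\<lambda>t. \<bar>g t\<bar> powr p)"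
      "integrable \<mu> (\<lambda>t. \<bar>h t\<bar> powr p)"
    and a: "0 \<le> a" "a \<le> 1"
  defines "I \<equiv> \<lambda>a y. LINT t|\<mu>. \<bar>a * f t + fst y * g t + snd y * h t\<bar> powr p"
    and "\<kappa> \<equiv> \<lambda>t. (\<bar>f t\<bar> + \<bar>g t\<bar> + \<bar>h t\<bar>) powr (p - 2) * (f t)\<^sup>2"
  shows "integrable \<mu> \<kappa>" "integrable square_measure (I a)"
    "2 * p * a\<^sup>2 * integral\<^sup>L \<mu> \<kappa> \<le> integral\<^sup>L square_measure (I a) - integral\<^sup>L square_measure (I 0)"
proof -
  interpret \<mu>: sigma_finite_measure \<mu> by fact
  interpret pair_sigma_finite square_measure \<mu> ..
  note [measurable] = meas
  have [measurable]: "fst \<in> borel_measurable square_measure" "snd \<in> borel_measurable square_measure"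
    by (auto intro!: borel_measurable_square_measure simp: borel_prod[symmetric])
  define s where "s = (\<lambda>t. \<bar>f t\<bar> + \<bar>g t\<bar> + \<bar>h t\<bar>)"
  define F where "F = (\<lambda>a (y, t). \<bar>a * f t + fst y * g t + snd y * h t\<bar> powr p)"
  have [measurable]: "F a \<in> borel_measurable (square_measure \<Otimes>\<^sub>M \<mu>)" for a
    unfolding F_def by measurable
  have int_s: "integrable \<mu> (\<lambda>t. s t powr p)"
  proof (rule Bochner_Integration.integrable_bound)
    show "integrable \<mu> (\<lambda>t. 3 powr p * (\<bar>f t\<bar> powr p + \<bar>g t\<bar> powr p + \<bar>h t\<bar> powr p))"
      using int by (intro integrable_mult_right Bochner_Integration.integrable_add)
  qed (use add3_powr_le[OF p(1)] s_def in auto)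
  show int_\<kappa>: "integrable \<mu> \<kappa>"
  proof (rule Bochner_Integration.integrable_bound[OF int(1)])
    have "\<kappa> t \<le> \<bar>f t\<bar> powr p" for t
    proof (cases "f t = 0")
      case False
      then have "\<kappa> t \<le> \<bar>f t\<bar> powr (p - 2) * (f t)\<^sup>2"
        unfolding \<kappa>_def using p by (intro mult_right_mono powr_mono2') auto
      also have "(f t)\<^sup>2 = \<bar>f t\<bar> powr 2" by simp
      finally show ?thesis by (simp only: powr_add[symmetric]) simp
    qed (simp add: \<kappa>_def)
    then show "AE t in \<mu>. norm (\<kappa> t) \<le> norm (\<bar>f t\<bar> powr p)"
      by (simp add: \<kappa>_def)
  qed (simp add: \<kappa>_def)
  \<comment> \<open>This is one integrable majorant for all \<open>a\<close> and \<open>y\<close> in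
    range; with the finite mass of the square it gives integrability on the product.\<close>
  have F_le: "F a (y, t) \<le> s t powr p"
    if "0 \<le> a" "a \<le> 1" "\<bar>fst y\<bar> \<le> 1" "\<bar>snd y\<bar> \<le> 1" for a y t
  proof -
    have "\<bar>a * f t\<bar> \<le> 1 * \<bar>f t\<bar>" "\<bar>fst y * g t\<bar> \<le> 1 * \<bar>g t\<bar>" "\<bar>snd y * h t\<bar> \<le> 1 * \<bar>h t\<bar>"
      using that by (auto simp: abs_mult intro: mult_left_le_one_le)
    then have "\<bar>a * f t + fst y * g t + snd y * h t\<bar> \<le> s t"
      unfolding s_def by linarith
    then show ?thesis
      unfolding F_def using p by (auto intro: powr_mono2)
  qed
  have AE_box: "AE y in square_measure. \<bar>fst y\<bar> \<le> 1 \<and> \<bar>snd y\<bar> \<le> 1"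
    by (rule AE_I2) (auto simp: square_measure_def space_restrict_space)
  have int_I: "integrable square_measure (I a)" and int_Fy: "AE y in square_measure. integrable \<mu> (\<lambda>t. F a (y, t))"
    if "0 \<le> a" "a \<le> 1" for a
  proof -
    show Fy: "AE y in square_measure. integrable \<mu> (\<lambda>t. F a (y, t))"
      using AE_box
    proof eventually_elim
      case (elim y)
      then show ?case
        using F_le[OF that] p
        by (intro Bochner_Integration.integrable_bound[OF int_s]) (auto simp: F_def)
    qed
    have I: "I a = (\<lambda>y. LINT t|\<mu>. F a (y, t))" by (simp add: I_def F_def)
    show "integrable square_measure (I a)"
    proof (rule square_measure.integrable_const_bound)
      show "AE y in square_measure. norm (I a y) \<le> LINT t|\<mu>. s t powr p"
        using AE_box Fy
      proof eventually_elim
        case (elim y)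
        have "0 \<le> I a y" by (simp add: I_def)
        moreover have "I a y \<le> LINT t|\<mu>. s t powr p"
          unfolding I using F_le[OF that] elim by (intro integral_mono int_s) auto
        ultimately show ?case by simp
      qed
      show "I a \<in> borel_measurable square_measure"
        unfolding I by measurable
    qed
  qed
  show "integrable square_measure (I a)" by (rule int_I[OF a])
  define J where "J = (\<lambda>a t. interval_sum (g t) (interval_sum (h t) (\<lambda>x. \<bar>x\<bar> powr p)) (a * f t))"
  have IJ: "integral\<^sup>L square_measure (I a) = integral\<^sup>L \<mu> (J a)" "integrable \<mu> (J a)"
    if "0 \<le> a" "a \<le> 1" for a
  proof -
    have int_F: "integrable (square_measure \<Otimes>\<^sub>M \<mu>) (F a)"
    proof (rule Fubini_integrable)
      have "I a = (\<lambda>y. LINT t|\<mu>. norm (F a (y, t)))" by (simp add: I_def F_def)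
      with int_I[OF that] show "integrable square_measure (\<lambda>y. LINT t|\<mu>. norm (F a (y, t)))" by simp
    qed (use int_Fy[OF that] in auto)
    have J: "J a = (\<lambda>t. LINT y|square_measure. F a (y, t))"
      unfolding J_def F_def prod.case using p
      by (subst integral_square_measure[symmetric]) (auto intro!: continuous_intros continuous_on_powr')
    show "integrable \<mu> (J a)"
      unfolding J by (rule integrable_snd) (use int_F in \<open>simp add: case_prod_beta'\<close>)
    have "I a = (\<lambda>y. LINT t|\<mu>. F a (y, t))" by (simp add: I_def F_def)
    then show "integral\<^sup>L square_measure (I a) = integral\<^sup>L \<mu> (J a)"
      unfolding J using Fubini_integral[of "\<lambda>y t. F a (y, t)"] int_F by (simp add: case_prod_beta')
  qed
  have "2 * p * a\<^sup>2 * integral\<^sup>L \<mu> \<kappa> = (LINT t|\<mu>. 2 * p * a\<^sup>2 * \<kappa> t)"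
    by simp
  also have "\<dots> \<le> (LINT t|\<mu>. J a t - J 0 t)"
  proof (rule integral_mono)
    fix t
    \<comment> \<open>As a \<le> 1 and p - 2 \<le> 0, writing |f t| for |a f t| in the base can only
      lower the power, provided the smaller base is positive. If \<open>a * f t = 0\<close>, both
      sides are 0.\<close>
    have "2 * p * a\<^sup>2 * \<kappa> t \<le> 2 * p * (\<bar>a * f t\<bar> + \<bar>g t\<bar> + \<bar>h t\<bar>) powr (p - 2) * (a * f t)\<^sup>2"
    proof (cases "a * f t = 0")
      case False
      have "\<bar>a * f t\<bar> \<le> 1 * \<bar>f t\<bar>"
        unfolding abs_mult using a by (intro mult_right_mono) auto
      moreover have "0 < \<bar>a * f t\<bar> + \<bar>g t\<bar> + \<bar>h t\<bar>"
        using False by (intro add_pos_nonneg) auto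
      ultimately have "(\<bar>f t\<bar> + \<bar>g t\<bar> + \<bar>h t\<bar>) powr (p - 2) \<le> (\<bar>a * f t\<bar> + \<bar>g t\<bar> + \<bar>h t\<bar>) powr (p - 2)"
        using p by (intro powr_mono2') auto
      then have "2 * p * (\<bar>f t\<bar> + \<bar>g t\<bar> + \<bar>h t\<bar>) powr (p - 2) * (a * f t)\<^sup>2
          \<le> 2 * p * (\<bar>a * f t\<bar> + \<bar>g t\<bar> + \<bar>h t\<bar>) powr (p - 2) * (a * f t)\<^sup>2"
        using p by (intro mult_right_mono mult_left_mono) auto
      then show ?thesis by (simp add: \<kappa>_def power_mult_distrib mult_ac)
    qed (auto simp: \<kappa>_def)
    also have "\<dots> \<le> J a t - J 0 t"
      using interval_sum_abs_powr_increment[OF p, of "a * f t" "g t" "h t"] by (simp add: J_def)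
    finally show "2 * p * a\<^sup>2 * \<kappa> t \<le> J a t - J 0 t" .
  qed (use int_\<kappa> IJ(2) a in \<open>auto intro!: integrable_mult_right Bochner_Integration.integrable_diff\<close>)
  also have "\<dots> = integral\<^sup>L square_measure (I a) - integral\<^sup>L square_measure (I 0)"
    using IJ a by (subst Bochner_Integration.integral_diff) auto
  finally show "2 * p * a\<^sup>2 * integral\<^sup>L \<mu> \<kappa> \<le> integral\<^sup>L square_measure (I a) - integral\<^sup>L square_measure (I 0)" .
qed

section \<open>Behaviour of M near 0 and comparison of Orlicz norms\<close>

text \<open>M'(y)/y tends to M''(0) = 0, so M'(z) \<le> \<epsilon> z for small z > 0, and the mean
  value theorem gives M(t) = M'(z) t \<le> \<epsilon> t^2 with some z < t.\<close>

lemma C2_half_little_o_square: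
  assumes "C2_half M" "M 0 = 0" "deriv_half M 0 = 0" "deriv_half (deriv_half M) 0 = 0" "0 < \<epsilon>"
  obtains \<eta> where "0 < \<eta>" "\<And>t. 0 \<le> t \<Longrightarrow> t < \<eta> \<Longrightarrow> M t \<le> \<epsilon> * t\<^sup>2"
proof -
  have diff: "M differentiable_on {0..}" "deriv_half M differentiable_on {0..}"
    using assms by (auto simp: C2_half_def)
  have "((\<lambda>y. deriv_half M y / y) \<longlongrightarrow> 0) (at 0 within {0..})"
    using deriv_half_works[OF diff(2), of 0] assms(3,4) by (simp add: has_field_derivative_iff)
  then obtain \<eta> where \<eta>: "0 < \<eta>"
    "\<And>y. 0 < y \<Longrightarrow> y < \<eta> \<Longrightarrow> \<bar>deriv_half M y / y\<bar> < \<epsilon>"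
    using \<open>0 < \<epsilon>\<close> unfolding Lim_within by (force simp: dist_real_def)
  have "M t \<le> \<epsilon> * t\<^sup>2" if t: "0 \<le> t" "t < \<eta>" for t
  proof (cases "t = 0")
    case True
    then show ?thesis using assms by simp
  next
    case False
    then have "0 < t" using t by simp
    have "continuous_on {0..t} M"
      using differentiable_imp_continuous_on[OF diff(1)] by (rule continuous_on_subset) auto
    moreover have "(M has_derivative (*) (deriv_half M z)) (at z)" if "0 < z" for z
      using deriv_half_works[OF diff(1), of z] that at_within_interior[of z "{0..}"]
      by (simp add: has_field_derivative_def)
    ultimately obtain z where z: "0 < z" "z < t" "M t - M 0 = deriv_half M z * (t - 0)"
      using mvt[OF \<open>0 < t\<close>, of M "\<lambda>z. (*) (deriv_half M z)"] by auto
    have "\<bar>deriv_half M z / z\<bar> < \<epsilon>"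
      using \<eta>(2)[of z] z t by auto
    then have "deriv_half M z / z \<le> \<epsilon>" by linarith
    then have "deriv_half M z \<le> \<epsilon> * z"
      using z by (simp add: field_simps)
    also have "\<dots> \<le> \<epsilon> * t"
      using z \<open>0 < \<epsilon>\<close> by simp
    finally have "deriv_half M z * t \<le> \<epsilon> * t * t"
      using \<open>0 < t\<close> by (intro mult_right_mono) auto
    then show ?thesis using z assms(2) by (simp add: power2_eq_square mult.assoc)
  qed
  with \<eta>(1) show ?thesis by (rule that)
qed

text \<open>Here q^p \<ge> q^2, and 1 - q^2 \<le> 2 (1 - q) because (1 - q)^2 \<ge> 0. With q a
  ratio of two norms, this linearises the difference of their p-th powers.\<close>

lemma one_minus_powr_le:
  fixes p q :: real
  assumes "0 < q" "q \<le> 1" "p \<le> 2"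
  shows "1 - q powr p \<le> 2 * (1 - q)"
proof -
  have "q\<^sup>2 = q powr 2" using assms by (simp add: powr_numeral)
  also have "\<dots> \<le> q powr p" using assms by (intro powr_mono') auto
  finally have "q\<^sup>2 \<le> q powr p" .
  moreover have "0 \<le> (1 - q)\<^sup>2" by simp
  ultimately show ?thesis by (simp add: power2_eq_square algebra_simps)
qed

context
  fixes M :: "real \<Rightarrow> real"
  assumes M: "orlicz_function M"
begin

lemma orlicz_function_nonneg: "0 \<le> t \<Longrightarrow> 0 \<le> M t"
  using M by (cases "t = 0") (auto simp: orlicz_function_def intro: less_imp_le)

lemma orlicz_function_scale_le:
  assumes "0 \<le> q" "q \<le> 1" "0 \<le> t"
  shows "M (q * t) \<le> q * M t"
proof -
  have "M ((1 - q) *\<^sub>R 0 + q *\<^sub>R t) \<le> (1 - q) * M 0 + q * M t"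
    by (rule convex_onD[of "{0..}"]) (use M assms in \<open>auto simp: orlicz_function_def\<close>)
  then show ?thesis using M by (simp add: orlicz_function_def)
qed

text \<open>Each term of the sum defining the norm is at most 1, so |x_i| / ||x|| cannot pass a
  point b where M(b) \<ge> 1.\<close>

lemma orlicz_norm_coordinate_bound:
  obtains b where "0 < b" "\<And>(x :: real ^ 'n::finite) i. \<bar>x $ i\<bar> \<le> b * orlicz_norm M x"
proof -
  \<comment> \<open>Convexity and M(0) = 0 give M(b) \<ge> b M(1) for b \<ge> 1, so this choice
    ensures M(b) \<ge> 1.\<close>
  define b where "b = max 1 (1 / M 1)"
  have M1: "0 < M 1" using M by (simp add: orlicz_function_def)
  then have b: "1 \<le> b" "1 \<le> b * M 1"
    by (auto simp: b_def max_def field_simps)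
  have "M (1 / b * b) \<le> 1 / b * M b"
    by (rule orlicz_function_scale_le) (use b in auto)
  then have "M 1 \<le> M b / b" using b by simp
  then have "1 \<le> M b" using b by (simp add: field_simps)
  have "\<bar>x $ i\<bar> \<le> b * orlicz_norm M x" for x :: "real ^ 'n" and i
  proof (cases "x = 0")
    case True
    then show ?thesis by (simp add: orlicz_norm_def)
  next
    case False
    note N = orlicz_norm_characterization[OF M False]
    have "M (\<bar>x $ i\<bar> / orlicz_norm M x) \<le> 1"
      unfolding N(2)[symmetric] using N(1) by (intro member_le_sum orlicz_function_nonneg) auto
    then have "\<not> b < \<bar>x $ i\<bar> / orlicz_norm M x"
      using orlicz_function_strict_mono[OF M, of b "\<bar>x $ i\<bar> / orlicz_norm M x"] b \<open>1 \<le> M b\<close> by auto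
    then show ?thesis using N(1) by (simp add: field_simps)
  qed
  then show ?thesis using that[of b] b by simp
qed

text \<open>Let G(s) be the defining sum for \<open>y\<close> at scale s. Then G(r0) = 1 and G(r) =
  1 - M(|x_k| / r), while convexity gives G(r) \<le> r0 / r. Hence 1 - r0 / r \<le> M(|x_k| / r),
  and \<open>one_minus_powr_le\<close> passes to p-th powers.\<close>

lemma orlicz_norm_drop_coordinate:
  fixes x y :: "real ^ 'n::finite"
  assumes y: "y \<noteq> 0" "y $ k = 0" "\<And>i. i \<noteq> k \<Longrightarrow> y $ i = x $ i" and "p \<le> 2"
  defines "r \<equiv> orlicz_norm M x" and "r0 \<equiv> orlicz_norm M y"
  shows "0 < r0" "r0 \<le> r" "M (\<bar>x $ k\<bar> / r) \<le> 1"
    "r powr p - r0 powr p \<le> 2 * r powr p * M (\<bar>x $ k\<bar> / r)"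
proof -
  have "x \<noteq> 0" using y by (metis vec_eq_iff zero_index)
  note r = orlicz_norm_characterization[OF M this, folded r_def]
  note r0 = orlicz_norm_characterization[OF M y(1), folded r0_def]
  define G where "G = (\<lambda>s. \<Sum>i\<in>UNIV. M (\<bar>y $ i\<bar> / s))"
  have M0: "M 0 = 0" using M by (simp add: orlicz_function_def)
  have G_scale: "G t \<le> s / t * G s" if "0 < s" "s \<le> t" for s t
  proof -
    have "M (\<bar>y $ i\<bar> / t) \<le> s / t * M (\<bar>y $ i\<bar> / s)" for i
      using orlicz_function_scale_le[of "s / t" "\<bar>y $ i\<bar> / s"] that by simp
    then show ?thesis unfolding G_def sum_distrib_left by (rule sum_mono)
  qed
  have "G r = (\<Sum>i\<in>UNIV - {k}. M (\<bar>x $ i\<bar> / r))"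
    unfolding G_def using y M0 by (subst sum.remove[of _ k]) (auto intro: sum.cong)
  then have Gr: "M (\<bar>x $ k\<bar> / r) + G r = 1"
    using r(2) by (subst (asm) sum.remove[of _ k]) auto
  have Gr0: "G r0 = 1" using r0 by (simp add: G_def)
  have nonneg: "0 \<le> M (\<bar>x $ k\<bar> / r)" "0 \<le> G r"
    using r by (auto simp: G_def intro!: orlicz_function_nonneg sum_nonneg)
  show "0 < r0" by fact
  \<comment> \<open>If r < r0, convexity would give 1 = G(r0) \<le> (r / r0) G(r) < 1.\<close>
  show le: "r0 \<le> r"
  proof (rule ccontr)
    assume "\<not> r0 \<le> r"
    then have "r / r0 < 1" using r r0 by simp
    moreover have "r / r0 * G r \<le> r / r0 * 1"
      using Gr nonneg r r0 by (intro mult_left_mono) auto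
    ultimately have "r / r0 * G r < 1" by linarith
    then show False using G_scale[of r r0] Gr0 r(1) \<open>\<not> r0 \<le> r\<close> by simp
  qed
  show "M (\<bar>x $ k\<bar> / r) \<le> 1" using Gr nonneg by simp
  have "1 - (r0 / r) powr p \<le> 2 * (1 - r0 / r)"
    using le r r0 \<open>p \<le> 2\<close> by (intro one_minus_powr_le) auto
  also have "\<dots> \<le> 2 * M (\<bar>x $ k\<bar> / r)"
    using G_scale[of r0 r] Gr Gr0 r0 le by simp
  finally have "r powr p * (1 - (r0 / r) powr p) \<le> r powr p * (2 * M (\<bar>x $ k\<bar> / r))"
    by (rule mult_left_mono) simp
  then show "r powr p - r0 powr p \<le> 2 * r powr p * M (\<bar>x $ k\<bar> / r)"
    using r r0 by (simp add: powr_divide right_diff_distrib)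
qed

end

section \<open>Coordinate functions of an embedding\<close>

text \<open>The representatives are chosen before the coefficients, so the same three functions
  serve every linear combination.\<close>

lemma L0_representatives:
  fixes F G H :: L0
  shows "\<exists>f\<in>borel_measurable unit_interval. \<exists>g\<in>borel_measurable unit_interval.
    \<exists>h\<in>borel_measurable unit_interval. \<forall>a b c.
      Lp_integrable p (a *\<^sub>R F + b *\<^sub>R G + c *\<^sub>R H) =
        integrable unit_interval (\<lambda>t. \<bar>a * f t + b * g t + c * h t\<bar> powr p) \<and>
      Lp_norm p (a *\<^sub>R F + b *\<^sub>R G + c *\<^sub>R H) =
        (LINT t|unit_interval. \<bar>a * f t + b * g t + c * h t\<bar> powr p) powr (1 / p)"
  apply transfer
  subgoal for p F G H
    by (rule bexI[of _ F], rule bexI[of _ G], rule bexI[of _ H]) auto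
  done

lemma embeds_isometrically_Lp_coordinates:
  fixes N :: "real ^ 3 \<Rightarrow> real"
  assumes "embeds_isometrically_Lp N p" "0 < p"
  obtains f g h where
    "f \<in> borel_measurable unit_interval" "g \<in> borel_measurable unit_interval"
    "h \<in> borel_measurable unit_interval"
    "\<And>a b c. integrable unit_interval (\<lambda>t. \<bar>a * f t + b * g t + c * h t\<bar> powr p)"
    "\<And>a b c. (LINT t|unit_interval. \<bar>a * f t + b * g t + c * h t\<bar> powr p) = N (vector [a, b, c]) powr p"
proof -
  obtain T :: "real ^ 3 \<Rightarrow> L0" where T: "linear T" "\<And>x. Lp_integrable p (T x)" "\<And>x. Lp_norm p (T x) = N x"
    using assms(1) by (auto simp: embeds_isometrically_Lp_def Lp_space_def)
  have *: "T (vector [a, b, c]) = a *\<^sub>R T (axis 1 1) + b *\<^sub>R T (axis 2 1) + c *\<^sub>R T (axis 3 1)" for a b c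
  proof -
    have "(vector [a, b, c] :: real ^ 3) = a *\<^sub>R axis 1 1 + b *\<^sub>R axis 2 1 + c *\<^sub>R axis 3 1"
      by (simp add: vec_eq_iff forall_3 axis_def)
    then show ?thesis by (simp add: linear_add[OF T(1)] linear_scale[OF T(1)])
  qed
  obtain f g h where fgh:
    "f \<in> borel_measurable unit_interval" "g \<in> borel_measurable unit_interval"
    "h \<in> borel_measurable unit_interval"
    "\<And>a b c. Lp_integrable p (T (vector [a, b, c])) \<longleftrightarrow>
        integrable unit_interval (\<lambda>t. \<bar>a * f t + b * g t + c * h t\<bar> powr p)"
    "\<And>a b c. Lp_norm p (T (vector [a, b, c])) =
        (LINT t|unit_interval. \<bar>a * f t + b * g t + c * h t\<bar> powr p) powr (1 / p)"
    using L0_representatives[of p "T (axis 1 1)" "T (axis 2 1)" "T (axis 3 1)"] unfolding * by blast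
  show ?thesis
  proof (rule that[OF fgh(1-3)])
    show "integrable unit_interval (\<lambda>t. \<bar>a * f t + b * g t + c * h t\<bar> powr p)" for a b c
      using fgh(4) T(2) by blast
    show "(LINT t|unit_interval. \<bar>a * f t + b * g t + c * h t\<bar> powr p) = N (vector [a, b, c]) powr p" for a b c
      using fgh(5)[of a b c] T(3) \<open>0 < p\<close> by (simp add: powr_powr integral_nonneg_AE)
  qed
qed

section \<open>Increments of the norm and the contradiction\<close>

text \<open>A bound M(s) \<le> k s^2 at s = a / N(a) cancels a^2 and leaves N(a)^(p-2), which is at
  most N(0)^(p-2) since p \<le> 2 and N(0) \<le> N(a). A fixed \<open>k\<close> will give
  domination, arbitrarily small \<open>k\<close> pointwise convergence.\<close>

lemma orlicz_norm_increment_le: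
  fixes M :: "real \<Rightarrow> real" and p a k :: real and y :: "real \<times> real"
  assumes M: "orlicz_function M" and p: "0 < p" "p \<le> 2" and y: "y \<noteq> 0" and "0 < a"
  defines "N \<equiv> \<lambda>a. orlicz_norm M (vector [a, fst y, snd y] :: real ^ 3)"
  shows "0 < N 0" "N 0 \<le> N a" "M (a / N a) \<le> 1" "0 \<le> (N a powr p - N 0 powr p) / a\<^sup>2"
    "0 \<le> k \<Longrightarrow> M (a / N a) \<le> k * (a / N a)\<^sup>2 \<Longrightarrow>
      (N a powr p - N 0 powr p) / a\<^sup>2 \<le> 2 * k * N 0 powr (p - 2)"
proof -
  have y0: "(vector [0, fst y, snd y] :: real ^ 3) \<noteq> 0"
    using y by (auto simp: vec_eq_iff forall_3 prod_eq_iff)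
  have y_eq: "vector [0, fst y, snd y] $ i = (vector [a, fst y, snd y] :: real ^ 3) $ i" if "i \<noteq> 1" for i
    using exhaust_3[of i] that by auto
  have *: "0 < N 0" "N 0 \<le> N a" "M (a / N a) \<le> 1"
    "N a powr p - N 0 powr p \<le> 2 * N a powr p * M (a / N a)"
    unfolding N_def
    using orlicz_norm_drop_coordinate[OF M y0, where k = 1, OF _ y_eq p(2)] \<open>0 < a\<close> by simp_all
  then show "0 < N 0" "N 0 \<le> N a" "M (a / N a) \<le> 1" by auto
  show "0 \<le> (N a powr p - N 0 powr p) / a\<^sup>2"
    using * p by (auto intro!: powr_mono2 divide_nonneg_nonneg)
  assume k: "0 \<le> k" "M (a / N a) \<le> k * (a / N a)\<^sup>2"
  have "N a powr p - N 0 powr p \<le> 2 * N a powr p * (k * (a / N a)\<^sup>2)"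
    using *(4) by (rule order_trans) (use k in \<open>auto intro!: mult_left_mono\<close>)
  also have "\<dots> = a\<^sup>2 * (2 * k * N a powr (p - 2))"
    using * by (simp add: powr_diff power_divide powr_numeral)
  also have "\<dots> \<le> a\<^sup>2 * (2 * k * N 0 powr (p - 2))"
    using * k p by (intro mult_left_mono powr_mono2') auto
  finally show "(N a powr p - N 0 powr p) / a\<^sup>2 \<le> 2 * k * N 0 powr (p - 2)"
    using \<open>0 < a\<close> by (simp add: field_simps)
qed

theorem theorem2:
  fixes M :: "real \<Rightarrow> real" and p :: real
  assumes "orlicz_function M"
    and "C2_half M"
    and "deriv_half M 0 = 0"
    and "deriv_half (deriv_half M) 0 = 0"
    and "0 < p" and "p \<le> 2"
  shows "\<not> embeds_isometrically_Lp (orlicz_norm M :: real ^ 3 \<Rightarrow> real) p"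
proof
  assume "embeds_isometrically_Lp (orlicz_norm M :: real ^ 3 \<Rightarrow> real) p"
  from embeds_isometrically_Lp_coordinates[OF this \<open>0 < p\<close>]
  obtain f g h where meas: "f \<in> borel_measurable unit_interval"
    "g \<in> borel_measurable unit_interval" "h \<in> borel_measurable unit_interval"
    and int: "\<And>a b c. integrable unit_interval (\<lambda>t. \<bar>a * f t + b * g t + c * h t\<bar> powr p)"
    and norm: "\<And>a b c. (LINT t|unit_interval. \<bar>a * f t + b * g t + c * h t\<bar> powr p)
      = orlicz_norm M (vector [a, b, c] :: real ^ 3) powr p"
    by blast
  define N where "N = (\<lambda>a (y :: real \<times> real). orlicz_norm M (vector [a, fst y, snd y] :: real ^ 3))"
  have N_eq: "orlicz_norm M (vector [a, fst y, snd y] :: real ^ 3) = N a y" for a y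
    by (simp add: N_def)
  define \<kappa> where "\<kappa> = (\<lambda>t. (\<bar>f t\<bar> + \<bar>g t\<bar> + \<bar>h t\<bar>) powr (p - 2) * (f t)\<^sup>2)"
  note M = assms(1) and C2 = assms(2) and p = assms(5,6)
  have M0: "M 0 = 0" using M by (simp add: orlicz_function_def)
  note incr = orlicz_norm_increment_le[OF M p, unfolded N_eq]
  interpret unit: finite_measure unit_interval
    by (rule finite_measure_lebesgue_on) simp
  have "integrable unit_interval (\<lambda>t. \<bar>f t\<bar> powr p)" "integrable unit_interval (\<lambda>t. \<bar>g t\<bar> powr p)"
    "integrable unit_interval (\<lambda>t. \<bar>h t\<bar> powr p)"
    using int[of 1 0 0] int[of 0 1 0] int[of 0 0 1] by simp_all
  note lower = Lp_square_average_increment[OF unit.sigma_finite_measure_axioms p meas this,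
      unfolded norm N_eq, folded \<kappa>_def]
  \<comment> \<open>These are the difference quotients at a = 1/(n+1), a sequence in (0, 1] that
    tends to 0.\<close>
  define D where "D = (\<lambda>n y. (N (1 / Suc n) y powr p - N 0 y powr p) / (1 / Suc n)\<^sup>2)"
  \<comment> \<open>Since \<open>\<kappa> t > 0\<close> wherever \<open>f t\<close> is nonzero, a
    zero integral would force f = 0 almost everywhere and the norm of (1, 0, 0) to vanish.\<close>
  have \<kappa>_pos: "0 < integral\<^sup>L unit_interval \<kappa>"
  proof (rule ccontr)
    have int_\<kappa>: "integrable unit_interval \<kappa>" by (rule lower(1)[of 0]) auto
    have nonneg: "AE t in unit_interval. 0 \<le> \<kappa> t" by (simp add: \<kappa>_def)
    assume "\<not> 0 < integral\<^sup>L unit_interval \<kappa>"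
    with integral_nonneg_AE[OF nonneg] have "integral\<^sup>L unit_interval \<kappa> = 0" by simp
    then have "AE t in unit_interval. \<kappa> t = 0"
      using integral_nonneg_eq_0_iff_AE[OF int_\<kappa> nonneg] by simp
    then have "AE t in unit_interval. \<bar>1 * f t + 0 * g t + 0 * h t\<bar> powr p = 0"
      by (rule eventually_mono) (auto simp: \<kappa>_def)
    then have "(LINT t|unit_interval. \<bar>1 * f t + 0 * g t + 0 * h t\<bar> powr p) = 0"
      by (rule integral_eq_zero_AE)
    then have "orlicz_norm M (vector [1, 0, 0] :: real ^ 3) = 0"
      unfolding norm by simp
    moreover have "(vector [1, 0, 0] :: real ^ 3) \<noteq> 0" by (simp add: vec_eq_iff forall_3)
    ultimately show False using orlicz_norm_characterization(1)[OF M] by fastforce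
  qed
  have "2 * p * integral\<^sup>L unit_interval \<kappa> \<le> integral\<^sup>L square_measure (D n)" for n
  proof -
    define a :: real where "a = 1 / Suc n"
    have a: "0 < a" "0 \<le> a" "a \<le> 1" by (auto simp: a_def)
    have "integral\<^sup>L square_measure (D n) =
        (integral\<^sup>L square_measure (\<lambda>y. N a y powr p) - integral\<^sup>L square_measure (\<lambda>y. N 0 y powr p)) / a\<^sup>2"
      unfolding D_def a_def[symmetric]
      using lower(2)[OF a(2,3)] lower(2)[of 0] by simp
    then have "a\<^sup>2 * (2 * p * integral\<^sup>L unit_interval \<kappa>) \<le> a\<^sup>2 * integral\<^sup>L square_measure (D n)"
      using lower(3)[OF a(2,3)] a by (simp add: mult_ac)
    then show ?thesis
      using a by simp
  qed
  moreover have "(\<lambda>n. integral\<^sup>L square_measure (D n)) \<longlonglongrightarrow> integral\<^sup>L square_measure (\<lambda>_. 0)"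
  proof -
    \<comment> \<open>The exponent is halved because N^(p-2) = (N^2)^q, and N^2 is at least |u v| /
      b^2 by the bounds on two coordinates.\<close>
    define q where "q = (p - 2) / 2"
    obtain b where b: "0 < b" "\<And>(x :: real ^ 3) i. \<bar>x $ i\<bar> \<le> b * orlicz_norm M x"
      by (rule orlicz_norm_coordinate_bound[OF M]) blast
    obtain \<eta> where \<eta>: "0 < \<eta>" "\<And>t. 0 \<le> t \<Longrightarrow> t < \<eta> \<Longrightarrow> M t \<le> 1 * t\<^sup>2"
      by (rule C2_half_little_o_square[OF C2 M0 assms(3,4) zero_less_one]) blast
    \<comment> \<open>Below \<eta>, M(t) \<le> t^2; from \<eta> on, M(t) \<le> 1 \<le> t^2 /
      \<eta>^2. Thus \<open>K\<close> works wherever M(t) \<le> 1.\<close>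
    define K where "K = max 1 (1 / \<eta>\<^sup>2)"
    have K: "M t \<le> K * t\<^sup>2" if "0 \<le> t" "M t \<le> 1" for t
    proof (cases "t < \<eta>")
      case True
      have "1 * t\<^sup>2 \<le> K * t\<^sup>2" unfolding K_def by (intro mult_right_mono) auto
      then show ?thesis using \<eta>(2)[OF that(1) True] by linarith
    next
      case False
      have "M t \<le> 1 / \<eta>\<^sup>2 * \<eta>\<^sup>2" using that \<eta>(1) by simp
      also have "\<dots> \<le> K * t\<^sup>2"
        using False \<eta>(1) unfolding K_def by (intro mult_mono power_mono) auto
      finally show ?thesis .
    qed
    show ?thesis
    proof (rule integral_dominated_convergence)
      show "integrable square_measure (\<lambda>y. 2 * K / (b\<^sup>2) powr q * \<bar>fst y * snd y\<bar> powr q)"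
        using p by (intro integrable_mult_right integrable_square_measure_abs_powr) (auto simp: q_def)
      show "D n \<in> borel_measurable square_measure" for n
        unfolding D_def using lower(2)[of "1 / Suc n"] lower(2)[of 0]
        by (intro borel_measurable_divide borel_measurable_diff) auto
      show "AE y in square_measure. (\<lambda>n. D n y) \<longlonglongrightarrow> 0"
        using AE_square_measure_off_axes
      proof eventually_elim
        case (elim y)
        then have y: "y \<noteq> 0" by auto
        define R where "R = N 0 y powr (p - 2)"
        have N0: "0 < N 0 y" by (rule incr(1)[OF y zero_less_one])
        then have R: "0 < R" by (simp add: R_def)
        show ?case
        proof (rule LIMSEQ_I)
          fix e :: real assume "0 < e"
          \<comment> \<open>Chosen so that 2 k R = e / 2.\<close>
          define k where "k = e / (4 * R)"
          have k: "0 < k" using \<open>0 < e\<close> R by (simp add: k_def)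
          obtain \<delta> where \<delta>: "0 < \<delta>" "\<And>t. 0 \<le> t \<Longrightarrow> t < \<delta> \<Longrightarrow> M t \<le> k * t\<^sup>2"
            by (rule C2_half_little_o_square[OF C2 M0 assms(3,4) k]) blast
          \<comment> \<open>Since N(0) \<le> N(a), this makes a / N(a) < \<delta> for all n from
            \<open>n0\<close> on.\<close>
          obtain n0 where n0: "1 / Suc n0 < \<delta> * N 0 y"
            using nat_approx_posE[of "\<delta> * N 0 y"] \<delta>(1) N0 by auto
          have "norm (D n y - 0) < e" if "n0 \<le> n" for n
          proof -
            define a :: real where "a = 1 / Suc n"
            have a: "0 < a" by (simp add: a_def)
            have "a \<le> 1 / Suc n0" unfolding a_def using that by (intro divide_left_mono) auto
            with n0 have "a < \<delta> * N 0 y" by simp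
            also have "\<dots> \<le> \<delta> * N a y" using \<delta>(1) incr(2)[OF y a] by simp
            finally have "a / N a y < \<delta>" using N0 incr(2)[OF y a] by (simp add: divide_less_eq)
            then have "M (a / N a y) \<le> k * (a / N a y)\<^sup>2"
              using a N0 incr(2)[OF y a] by (intro \<delta>(2)) auto
            from incr(5)[OF y a less_imp_le[OF k] this] have "D n y \<le> e / 2"
              using R by (simp add: D_def a_def R_def k_def)
            moreover have "0 \<le> D n y" using incr(4)[OF y a] by (simp add: D_def a_def)
            ultimately show ?thesis using \<open>0 < e\<close> by simp
          qed
          then show "\<exists>n0. \<forall>n\<ge>n0. norm (D n y - 0) < e" by blast
        qed
      qed
      \<comment> \<open>On the axes the majorant is 0, because \<open>0 powr q = 0\<close>, so the
        estimate is made only off this null set.\<close>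
      show "AE y in square_measure. norm (D n y) \<le> 2 * K / (b\<^sup>2) powr q * \<bar>fst y * snd y\<bar> powr q" for n
        using AE_square_measure_off_axes
      proof eventually_elim
        case (elim y)
        then have y: "y \<noteq> 0" by auto
        define a :: real where "a = 1 / Suc n"
        have a: "0 < a" by (simp add: a_def)
        have N0: "0 < N 0 y" by (rule incr(1)[OF y a])
        have "M (a / N a y) \<le> K * (a / N a y)\<^sup>2"
          using a N0 incr(2,3)[OF y a] by (intro K) auto
        from incr(5)[OF y a _ this] have D_le: "D n y \<le> 2 * K * N 0 y powr (p - 2)"
          by (simp add: D_def a_def K_def)
        have N_sq: "(N 0 y)\<^sup>2 = N 0 y powr 2"
          using N0 by (simp add: powr_numeral)
        have "N 0 y powr (p - 2) = (N 0 y)\<^sup>2 powr q"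
          unfolding N_sq powr_powr q_def by (rule arg_cong[of _ _ "(powr) _"]) simp
        also have "\<dots> \<le> (\<bar>fst y * snd y\<bar> / b\<^sup>2) powr q"
        proof (rule powr_mono2')
          have "\<bar>fst y\<bar> * \<bar>snd y\<bar> \<le> (b * N 0 y) * (b * N 0 y)"
            using b(2)[of "vector [0, fst y, snd y]" 2] b(2)[of "vector [0, fst y, snd y]" 3]
            by (intro mult_mono) (auto simp: N_def)
          also have "\<dots> = (N 0 y)\<^sup>2 * b\<^sup>2"
            by (simp add: power2_eq_square)
          finally show "\<bar>fst y * snd y\<bar> / b\<^sup>2 \<le> (N 0 y)\<^sup>2"
            using b(1) by (simp add: divide_le_eq abs_mult)
          show "0 < \<bar>fst y * snd y\<bar> / b\<^sup>2" using elim b(1) by simp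
        qed (use p q_def in auto)
        also have "\<dots> = \<bar>fst y * snd y\<bar> powr q / (b\<^sup>2) powr q"
          by (rule powr_divide)
        finally have "2 * K * N 0 y powr (p - 2)
            \<le> 2 * K * (\<bar>fst y * snd y\<bar> powr q / (b\<^sup>2) powr q)"
          by (rule mult_left_mono) (simp add: K_def)
        also have "\<dots> = 2 * K / (b\<^sup>2) powr q * \<bar>fst y * snd y\<bar> powr q"
          by (simp only: times_divide_eq_left times_divide_eq_right)
        finally have "D n y \<le> 2 * K / (b\<^sup>2) powr q * \<bar>fst y * snd y\<bar> powr q"
          using D_le by (rule order_trans[rotated])
        moreover have "0 \<le> D n y" using incr(4)[OF y a] by (simp add: D_def a_def)
        ultimately show ?case unfolding real_norm_def by (simp only: abs_of_nonneg)
      qed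
    qed simp
  qed
  ultimately have "2 * p * integral\<^sup>L unit_interval \<kappa> \<le> integral\<^sup>L square_measure (\<lambda>_. 0)"
    by (intro LIMSEQ_le_const) auto
  moreover have "0 < 2 * p * integral\<^sup>L unit_interval \<kappa>"
    using p \<kappa>_pos by simp
  ultimately show False by simp
qed

end
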